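(* Let $G=(V,E)$ be a finite connected undirected graph, let $\lambda>0$, and for each $v\in V$ let $f_v:\mathbb{R}\to\mathbb{R}$ be a convex function, such that $\inf_{x\in\mathbb{R}}\sum_{v\in V}f_v(x)$ is attained at some point of $\mathbb{R}$. Let $x^\star\in\mathbb{R}$. Consider the following statements. 1) $x^\star 1_V$ is a minimizer over $x\in\mathbb{R}^V$ of $\sum_{v\in V} f_v(x(v))+\lambda\|x\|_{\mathrm{TV}}$. 2) $\partial F(x^\star 1_V)\cap\lambda B_*$ is nonempty. 3) There exists $u\in\partial F(x^\star 1_V)$ such that $\sum_{v\in V}u(v)=0$ and, for all $A\subset V$, $\sum_{v\in A}u(v)\le\lambda\,\mathrm{Per}(A)$. 4) $x^\star$ is a minimizer over $x\in\mathbb{R}$ of $\sum_{v\in V}f_v(x)$. Then statements 1), 2), 3) are equivalent, and they imply 4).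
   Context: $\mathbb{R}^V$ is the space of functions $V\to\mathbb{R}$ with the standard scalar product $\langle f,g\rangle=\sum_{v\in V}f(v)g(v)$; $1_V$ is the constant function $1$ on $V$ and $1_A$ is the indicator function of $A\subset V$. For $x\in\mathbb{R}^V$, $\|x\|_{\mathrm{TV}}=\sum_{\{v,w\}\in E}|x(v)-x(w)|$, and the perimeter of $A\subset V$ is $\mathrm{Per}(A)=\|1_A\|_{\mathrm{TV}}$. Let $\mathbb{R}^V_0=\{x\in\mathbb{R}^V:\langle x,1_V\rangle=0\}$; since $G$ is connected, $\|\cdot\|_{\mathrm{TV}}$ is a norm on $\mathbb{R}_0^V$. For $u\in\mathbb{R}_0^V$ the dual norm is $\|u\|_*=\max\{\langle x,u\rangle:x\in\mathbb{R}_0^V,\ \|x\|_{\mathrm{TV}}\le 1\}$, and $B_*=\{u\in\mathbb{R}_0^V:\|u\|_*\le 1\}$. The function $F:\mathbb{R}^V\to\mathbb{R}$ is $F(x)=\sum_{v\in V}f_v(x(v))$; its subdifferential at $x1_V$ ($x\in\mathbb{R}$) is $\partial F(x1_V)=\{u\in\mathbb{R}^V:\forall v\in V,\ u(v)\in\partial f_v(x)\}$, where $\partial f_v$ is the convex subdifferential. *)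

theory Defs
  imports "HOL-Analysis.Analysis"
begin

text \<open>
  The vertex set is the whole (finite, nonempty) type \<open>'v\<close>, and an edge is an unordered pair
  \<open>{v, w}\<close>. Loops \<open>{v, v} = {v}\<close> are not excluded: they do not
  contribute to the total variation.
\<close>

definition undirected_edges :: "'v set set \<Rightarrow> bool" where
  "undirected_edges E \<longleftrightarrow> (\<forall>e\<in>E. \<exists>v w. e = {v, w})"

lemma undirected_edgesE:
  assumes "undirected_edges E" "e \<in> E"
  obtains v w where "e = {v, w}"
  using bspec[OF assms(1)[unfolded undirected_edges_def] assms(2)] by (elim exE) (rule that)

definition connected_graph :: "'v::finite set set \<Rightarrow> bool" where
  "connected_graph E \<longleftrightarrow>
     undirected_edges E \<and> (\<forall>v w. (v, w) \<in> {(a, b). {a, b} \<in> E}\<^sup>*)"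

definition edge_jump :: "real ^ 'v \<Rightarrow> 'v::finite set \<Rightarrow> real" where
  "edge_jump x e = (THE d. \<exists>v w. e = {v, w} \<and> d = \<bar>x $ v - x $ w\<bar>)"

lemma edge_jump_pair [simp]: "edge_jump x {v, w} = \<bar>x $ v - x $ w\<bar>"
proof -
  have "d = \<bar>x $ v - x $ w\<bar>" if "\<exists>a b. {v, w} = {a, b} \<and> d = \<bar>x $ a - x $ b\<bar>" for d
    using that by (metis abs_minus_commute doubleton_eq_iff)
  then show ?thesis unfolding edge_jump_def by (intro the_equality) blast+
qed

definition tv_norm :: "'v::finite set set \<Rightarrow> real ^ 'v \<Rightarrow> real" where
  "tv_norm E x = (\<Sum>e\<in>E. edge_jump x e)"

definition perimeter :: "'v::finite set set \<Rightarrow> 'v set \<Rightarrow> real" where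
  "perimeter E A = tv_norm E (\<chi> v. indicator A v)"

text \<open>
  The constant function 1 on the vertices is \<open>1 :: real ^ 'v\<close>, whose components are all 1.
\<close>

definition zero_mean :: "(real ^ 'v::finite) set" where
  "zero_mean = {x. x \<bullet> 1 = 0}"

text \<open>
  For a connected graph the supremum below is a maximum; see \<open>dual_tv_norm_attained\<close>.
\<close>

definition dual_tv_norm :: "'v::finite set set \<Rightarrow> real ^ 'v \<Rightarrow> real" where
  "dual_tv_norm E u = Sup {x \<bullet> u | x. x \<in> zero_mean \<and> tv_norm E x \<le> 1}"

definition dual_tv_ball :: "'v::finite set set \<Rightarrow> (real ^ 'v) set" where
  "dual_tv_ball E = {u \<in> zero_mean. dual_tv_norm E u \<le> 1}"

definition subdifferential :: "('a::real_inner \<Rightarrow> real) \<Rightarrow> 'a \<Rightarrow> 'a set" where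
  "subdifferential g x = {s. \<forall>y. g y \<ge> g x + s \<bullet> (y - x)}"

definition separable_sum :: "('v::finite \<Rightarrow> real \<Rightarrow> real) \<Rightarrow> real ^ 'v \<Rightarrow> real" where
  "separable_sum f x = (\<Sum>v\<in>UNIV. f v (x $ v))"

lemma subdifferential_separable_sum:
  "subdifferential (separable_sum f) (c *\<^sub>R 1) = {u. \<forall>v. u $ v \<in> subdifferential (f v) c}"
proof (intro set_eqI iffI; clarsimp)
  fix u v assume u: "u \<in> subdifferential (separable_sum f) (c *\<^sub>R 1)"
  show "u $ v \<in> subdifferential (f v) c"
    unfolding subdifferential_def
  proof clarsimp
    fix t :: real
    let ?y = "c *\<^sub>R 1 + axis v (t - c) :: real ^ 'a"
    have "separable_sum f ?y \<ge> separable_sum f (c *\<^sub>R 1) + u \<bullet> (?y - c *\<^sub>R 1)"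
      using u unfolding subdifferential_def by blast
    moreover have "separable_sum f ?y = f v t + (\<Sum>w\<in>UNIV - {v}. f w c)"
      unfolding separable_sum_def
      by (subst sum.remove[of _ v]) (auto simp: axis_def intro!: sum.cong)
    moreover have "separable_sum f (c *\<^sub>R 1) = f v c + (\<Sum>w\<in>UNIV - {v}. f w c)"
      unfolding separable_sum_def
      by (subst sum.remove[of _ v]) auto
    ultimately show "f v c + u $ v * (t - c) \<le> f v t"
      by (simp add: inner_axis)
  qed
next
  fix u assume u: "\<forall>v. u $ v \<in> subdifferential (f v) c"
  show "u \<in> subdifferential (separable_sum f) (c *\<^sub>R 1)"
    unfolding subdifferential_def
  proof clarsimp
    fix y :: "real ^ 'a"
    have "(\<Sum>v\<in>UNIV. f v c + u $ v * (y $ v - c)) \<le> (\<Sum>v\<in>UNIV. f v (y $ v))"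
      using u by (intro sum_mono) (auto simp: subdifferential_def)
    then show "separable_sum f (c *\<^sub>R 1) + u \<bullet> (y - c *\<^sub>R 1) \<le> separable_sum f y"
      by (simp add: separable_sum_def inner_vec_def sum.distrib)
  qed
qed

lemma edge_jump_nonneg:
  assumes "undirected_edges E" "e \<in> E"
  shows "edge_jump x e \<ge> 0"
proof -
  obtain v w where "e = {v, w}" using undirected_edgesE[OF assms] .
  then show ?thesis by (simp only: edge_jump_pair abs_ge_zero)
qed

lemma edge_jump_le_tv_norm:
  fixes E :: "'v::finite set set"
  assumes "undirected_edges E" "{v, w} \<in> E"
  shows "\<bar>x $ v - x $ w\<bar> \<le> tv_norm E x"
proof -
  have "edge_jump x {v, w} \<le> (\<Sum>e\<in>E. edge_jump x e)"
    by (rule member_le_sum[OF assms(2)]) (use edge_jump_nonneg[OF assms(1)] in simp_all)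
  then show ?thesis by (simp only: tv_norm_def edge_jump_pair)
qed

lemma tv_norm_bounds_difference:
  assumes "undirected_edges E" "(v, w) \<in> {(a, b). {a, b} \<in> E}\<^sup>*"
  shows "\<exists>C. \<forall>x. tv_norm E x \<le> 1 \<longrightarrow> \<bar>x $ v - x $ w\<bar> \<le> C"
  using assms(2)
proof induction
  case base
  show ?case by auto
next
  case (step a b)
  then obtain C where C: "\<And>x. tv_norm E x \<le> 1 \<Longrightarrow> \<bar>x $ v - x $ a\<bar> \<le> C" by blast
  have "\<bar>x $ v - x $ b\<bar> \<le> C + 1" if "tv_norm E x \<le> 1" for x
    using C[OF that] edge_jump_le_tv_norm[OF assms(1), of a b x] step.hyps(2) that by auto
  then show ?case by blast
qed

lemma bounded_tv_ball:
  fixes E :: "'v::finite set set"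
  assumes "connected_graph E"
  shows "bounded {x \<in> zero_mean. tv_norm E x \<le> 1}"
proof -
  have "\<forall>p::'v \<times> 'v. \<exists>C. \<forall>x. tv_norm E x \<le> 1 \<longrightarrow> \<bar>x $ fst p - x $ snd p\<bar> \<le> C"
    using assms tv_norm_bounds_difference[of E] unfolding connected_graph_def by blast
  then obtain C where
    C: "\<And>p x. tv_norm E x \<le> 1 \<Longrightarrow> \<bar>x $ fst p - x $ snd p\<bar> \<le> C (p::'v \<times> 'v)"
    by metis
  define M where "M = Max (range C)"
  have CM: "C p \<le> M" for p unfolding M_def by (rule Max_ge) auto
  have M: "\<bar>x $ v - x $ w\<bar> \<le> M" if "tv_norm E x \<le> 1" for x v w
    using C[OF that, of "(v, w)"] CM[of "(v, w)"] by simp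
  have "norm x \<le> real CARD('v) * M" if x: "x \<in> zero_mean" "tv_norm E x \<le> 1" for x
  proof -
    have z: "(\<Sum>w\<in>UNIV. x $ w) = 0"
      using x(1) by (simp add: zero_mean_def inner_vec_def)
    have "\<bar>x $ v\<bar> \<le> M" for v
    proof -
      have "real CARD('v) * \<bar>x $ v\<bar> = \<bar>\<Sum>w\<in>UNIV. (x $ v - x $ w)\<bar>"
        by (simp add: sum_subtractf z abs_mult)
      also have "\<dots> \<le> (\<Sum>w\<in>(UNIV::'v set). M)"
        by (rule order_trans[OF sum_abs]) (intro sum_mono M x(2))
      finally show ?thesis by simp
    qed
    then have "(\<Sum>v\<in>UNIV. \<bar>x $ v\<bar>) \<le> (\<Sum>v\<in>(UNIV::'v set). M)"
      by (intro sum_mono)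
    then show ?thesis using norm_le_l1_cart[of x] by simp
  qed
  then show ?thesis unfolding bounded_iff by blast
qed

lemma continuous_tv_norm:
  fixes E :: "'v::finite set set"
  assumes "undirected_edges E"
  shows "continuous_on UNIV (tv_norm E)"
proof -
  have "continuous_on UNIV (\<lambda>x. edge_jump x e)" if "e \<in> E" for e
  proof -
    obtain v w where e: "e = {v, w}" using undirected_edgesE[OF assms \<open>e \<in> E\<close>] .
    have "continuous_on UNIV (\<lambda>x::real ^ 'v. \<bar>x $ v - x $ w\<bar>)"
      by (rule continuous_on_rabs[OF continuous_on_diff[OF continuous_on_component continuous_on_component]])
        (rule continuous_on_id)+
    then show ?thesis by (simp add: e)
  qed
  then have "continuous_on UNIV (\<lambda>x. \<Sum>e\<in>E. edge_jump x e)"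
    by (rule continuous_on_sum)
  moreover have "tv_norm E = (\<lambda>x. \<Sum>e\<in>E. edge_jump x e)"
    by (rule ext) (rule tv_norm_def)
  ultimately show ?thesis by (simp only:)
qed

lemma compact_tv_ball:
  fixes E :: "'v::finite set set"
  assumes "connected_graph E"
  shows "compact {x \<in> zero_mean. tv_norm E x \<le> 1}"
proof -
  have "{x \<in> zero_mean. tv_norm E x \<le> 1} = {x. x \<bullet> 1 = 0} \<inter> {x. tv_norm E x \<le> 1}"
    by (auto simp: zero_mean_def)
  moreover have "closed {x::real ^ 'v. x \<bullet> 1 = 0}"
    by (rule closed_Collect_eq) (intro continuous_intros)+
  moreover have "closed {x. tv_norm E x \<le> 1}"
    using assms
    by (auto simp: connected_graph_def
        intro: closed_Collect_le[OF continuous_tv_norm continuous_on_const])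
  ultimately show ?thesis
    using bounded_tv_ball[OF assms] by (simp add: compact_eq_bounded_closed closed_Int)
qed

lemma dual_tv_norm_attained:
  fixes E :: "'v::finite set set"
  assumes "connected_graph E"
  obtains x where "x \<in> zero_mean" "tv_norm E x \<le> 1" "x \<bullet> u = dual_tv_norm E u"
    "\<And>y. y \<in> zero_mean \<Longrightarrow> tv_norm E y \<le> 1 \<Longrightarrow> y \<bullet> u \<le> dual_tv_norm E u"
proof -
  have "edge_jump 0 e = 0" if "e \<in> E" for e
  proof -
    obtain v w where "e = {v, w}"
      using undirected_edgesE[OF conjunct1[OF assms[unfolded connected_graph_def]] \<open>e \<in> E\<close>] .
    then show ?thesis by (simp only: edge_jump_pair) simp
  qed
  then have "0 \<in> {x \<in> zero_mean. tv_norm E x \<le> 1}"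
    by (simp add: zero_mean_def tv_norm_def)
  then have ne: "{x \<in> zero_mean. tv_norm E x \<le> 1} \<noteq> {}" by blast
  have "continuous_on {x \<in> zero_mean. tv_norm E x \<le> 1} (\<lambda>x. x \<bullet> u)"
    by (intro continuous_intros)
  from continuous_attains_sup[OF compact_tv_ball[OF assms] ne this]
  obtain x where x: "x \<in> zero_mean" "tv_norm E x \<le> 1"
    and max: "\<And>y. y \<in> zero_mean \<Longrightarrow> tv_norm E y \<le> 1 \<Longrightarrow> y \<bullet> u \<le> x \<bullet> u"
    by blast
  have "dual_tv_norm E u = x \<bullet> u"
    unfolding dual_tv_norm_def by (rule cSup_eq_maximum) (use x max in auto)
  then show thesis using that x max by simp
qed

end

theory Submission
  imports Defs
begin

text \<open>
  The statements 1), 2) and 3) are all equivalent to the existence of a subgradient \<open>u\<close> of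
  \<open>F\<close> at the constant function such that
  \<open>u \<bullet> x \<le> \<lambda> TV(x)\<close> for every \<open>x\<close>. For 1), such
  a \<open>u\<close> comes from a hyperplane separating the strict epigraph of \<open>F\<close> from the
  hypograph of \<open>-\<lambda> TV\<close>. For 3), \<open>x\<close> is decomposed into indicators of
  its superlevel sets, along which \<open>TV\<close> is additive (coarea formula).
\<close>

section \<open>Total variation as a seminorm invariant under adding constants\<close>

lemma tv_norm_scale:
  assumes "undirected_edges E"
  shows "tv_norm E (c *\<^sub>R x) = \<bar>c\<bar> * tv_norm E x"
proof -
  have "edge_jump (c *\<^sub>R x) e = \<bar>c\<bar> * edge_jump x e" if e: "e \<in> E" for e
  proof -
    obtain v w where "e = {v, w}" using undirected_edgesE[OF assms e] .
    then show ?thesis by (simp add: abs_mult flip: right_diff_distrib)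
  qed
  then show ?thesis by (simp add: tv_norm_def sum_distrib_left)
qed

lemma tv_norm_triangle:
  fixes E :: "'v::finite set set"
  assumes "undirected_edges E"
  shows "tv_norm E (x + y) \<le> tv_norm E x + tv_norm E y"
proof -
  have "edge_jump (x + y) e \<le> edge_jump x e + edge_jump y e" if e: "e \<in> E" for e
  proof -
    obtain v w where "e = {v, w}" using undirected_edgesE[OF assms e] .
    then show ?thesis by simp
  qed
  then show ?thesis by (simp add: tv_norm_def sum_mono flip: sum.distrib)
qed

lemma tv_norm_add_const:
  assumes "undirected_edges E"
  shows "tv_norm E (x + c *\<^sub>R 1) = tv_norm E x"
  unfolding tv_norm_def
proof (rule sum.cong[OF refl])
  fix e assume "e \<in> E"
  then obtain v w where "e = {v, w}" using undirected_edgesE[OF assms] by blast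
  then show "edge_jump (x + c *\<^sub>R 1) e = edge_jump x e" by simp
qed

lemma tv_norm_const:
  assumes "undirected_edges E"
  shows "tv_norm E (c *\<^sub>R 1) = 0"
  using tv_norm_add_const[OF assms, of 0 c] tv_norm_scale[OF assms, of 0 0] by simp

lemma tv_norm_nonneg:
  assumes "undirected_edges E"
  shows "tv_norm E x \<ge> 0"
  unfolding tv_norm_def by (intro sum_nonneg edge_jump_nonneg[OF assms])

section \<open>Coarea decomposition and testing on vertex sets\<close>

lemma inner_one_vec: "x \<bullet> (1 :: real ^ 'v::finite) = (\<Sum>v\<in>UNIV. x $ v)"
  by (simp add: inner_vec_def)

text \<open>One layer of the coarea formula. On an edge with exactly one endpoint in the top level
  set, the other endpoint is at most \<open>m'\<close>, so capping at \<open>m'\<close> shortens the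
  jump by exactly \<open>m - m'\<close>. On every other edge capping changes no jump, and the
  indicator has none.\<close>

lemma tv_norm_split_top_level:
  fixes E :: "'v::finite set set"
  assumes "undirected_edges E" "m' \<le> m"
    and "\<And>v. x $ v = m \<or> x $ v \<le> m'"
  shows "tv_norm E x =
    tv_norm E (\<chi> v. min (x $ v) m') + (m - m') * perimeter E {v. x $ v = m}"
proof -
  have "edge_jump x e = edge_jump (\<chi> v. min (x $ v) m') e
      + (m - m') * edge_jump (\<chi> v. indicator {v. x $ v = m} v) e" if e: "e \<in> E" for e
  proof -
    obtain v w where "e = {v, w}" using undirected_edgesE[OF assms(1) e] .
    then show ?thesis
      using assms(2) assms(3)[of v] assms(3)[of w]
      by (auto simp: indicator_def min_def)
  qed
  then show ?thesis
    by (simp add: tv_norm_def perimeter_def sum.distrib sum_distrib_left)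
qed

text \<open>Induction on the number of values of \<open>x\<close>. A constant pairs to 0 with
  \<open>u\<close> because the entries of \<open>u\<close> sum to 0. Otherwise the top layer is
  peeled off: pairing with \<open>u\<close> and total variation both split additively, and
  \<open>uA\<close> bounds the contribution of the layer.\<close>

lemma inner_le_tv_norm_if_perimeter:
  fixes E :: "'v::finite set set" and u :: "real ^ 'v"
  assumes E: "undirected_edges E"
    and u0: "(\<Sum>v\<in>UNIV. u $ v) = 0"
    and uA: "\<And>A. (\<Sum>v\<in>A. u $ v) \<le> lam * perimeter E A"
  shows "u \<bullet> x \<le> lam * tv_norm E x"
proof (induction "card (range (($) x))" arbitrary: x rule: less_induct)
  case less
  let ?R = "range (($) x)"
  define m where "m = Max ?R"
  have m: "m \<in> ?R" unfolding m_def by (rule Max_in) auto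
  have le_m: "x $ v \<le> m" for v unfolding m_def by (rule Max_ge) auto
  show ?case
  proof (cases "?R = {m}")
    case True
    then have "x = m *\<^sub>R 1" by (auto simp: vec_eq_iff)
    then show ?thesis using u0 tv_norm_const[OF E] by (simp add: inner_one_vec)
  next
    case False
    then have ne: "?R - {m} \<noteq> {}" using m by auto
    define m' where "m' = Max (?R - {m})"
    have m': "m' \<in> ?R - {m}" unfolding m'_def using ne by (intro Max_in) auto
    have le_m': "x $ v = m \<or> x $ v \<le> m'" for v
    proof (cases "x $ v = m")
      case False
      then show ?thesis unfolding m'_def by (intro disjI2 Max_ge) auto
    qed simp
    have lt: "m' < m" using m' le_m by (metis DiffE imageE insertI1 order_le_less)
    \<comment> \<open>Capping at the second largest value \<open>m'\<close> merges the two top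
      levels: \<open>y\<close> takes only values of \<open>x\<close> other than \<open>m\<close>, so
      the induction hypothesis applies, and \<open>x\<close> is \<open>y\<close> plus
      \<open>m - m'\<close> times the indicator of \<open>A\<close>.\<close>
    define y :: "real ^ 'v" where "y = (\<chi> v. min (x $ v) m')"
    define A where "A = {v. x $ v = m}"
    have "range (($) y) \<subseteq> ?R - {m}"
      using m' lt by (auto simp: y_def min_def)
    then have "range (($) y) \<subset> ?R" using m by blast
    then have "card (range (($) y)) < card ?R" by (intro psubset_card_mono) auto
    then have IH: "u \<bullet> y \<le> lam * tv_norm E y" by (rule less)
    have "x $ v = y $ v + (m - m') * indicator A v" for v
      using le_m'[of v] lt by (auto simp: y_def A_def indicator_def min_def)
    then have "u \<bullet> x = (\<Sum>v\<in>UNIV. u $ v * (y $ v + (m - m') * indicator A v))"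
      by (simp only: inner_vec_def inner_real_def)
    also have "\<dots> = u \<bullet> y + (m - m') * (\<Sum>v\<in>A. u $ v)"
    proof -
      have "(\<Sum>v\<in>UNIV. u $ v * ((m - m') * indicator A v)) = (\<Sum>v\<in>A. (m - m') * u $ v)"
        by (rule sum.mono_neutral_cong_right) (auto simp: indicator_def)
      then show ?thesis
        by (simp only: inner_vec_def inner_real_def distrib_left sum.distrib sum_distrib_left)
    qed
    also have "\<dots>
        \<le> lam * tv_norm E y + (m - m') * (lam * perimeter E A)"
      using IH uA[of A] lt by (intro add_mono mult_left_mono) auto
    also have "\<dots> = lam * tv_norm E x"
      unfolding tv_norm_split_top_level[OF E order_less_imp_le[OF lt] le_m'] y_def A_def
      by (simp add: distrib_left mult.left_commute)
    finally show ?thesis .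
  qed
qed

text \<open>The total variation vanishes at both \<open>1\<close> and \<open>-1\<close>, so the
  one-sided bound holds with both signs.\<close>

lemma zero_sum_if_inner_le_tv_norm:
  fixes u :: "real ^ 'v::finite"
  assumes "undirected_edges E" "\<And>x. u \<bullet> x \<le> lam * tv_norm E x"
  shows "(\<Sum>v\<in>UNIV. u $ v) = 0"
  using assms(2)[of "1 *\<^sub>R 1"] assms(2)[of "(-1) *\<^sub>R 1"]
  unfolding tv_norm_const[OF assms(1)] by (simp add: inner_one_vec)

text \<open>Forwards, the bound is tested on constants and on indicators; backwards, the layers of
  \<open>x\<close> are summed.\<close>

lemma inner_le_tv_norm_iff_perimeter:
  fixes E :: "'v::finite set set"
  assumes "undirected_edges E"
  shows "(\<forall>x. u \<bullet> x \<le> lam * tv_norm E x) \<longleftrightarrow>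
    (\<Sum>v\<in>UNIV. u $ v) = 0 \<and> (\<forall>A. (\<Sum>v\<in>A. u $ v) \<le> lam * perimeter E A)"
proof safe
  fix A assume *: "\<forall>x. u \<bullet> x \<le> lam * tv_norm E x"
  have "(\<Sum>v\<in>A. u $ v) = u \<bullet> (\<chi> v. indicator A v)"
    by (simp add: inner_vec_def indicator_def)
  then show "(\<Sum>v\<in>A. u $ v) \<le> lam * perimeter E A"
    using * by (simp add: perimeter_def)
qed (use assms inner_le_tv_norm_if_perimeter zero_sum_if_inner_le_tv_norm in blast)+

section \<open>The dual ball as a one-sided bound on all functions\<close>

lemma dual_tv_ball_iff:
  fixes E :: "'v::finite set set"
  assumes "connected_graph E"
  shows "w \<in> dual_tv_ball E \<longleftrightarrow> (\<forall>x. w \<bullet> x \<le> tv_norm E x)"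
proof
  have E: "undirected_edges E" using assms by (simp add: connected_graph_def)
  assume w: "w \<in> dual_tv_ball E"
  then have w0: "w \<bullet> 1 = 0" and w1: "dual_tv_norm E w \<le> 1"
    by (auto simp: dual_tv_ball_def zero_mean_def)
  have bound: "y \<bullet> w \<le> 1" if "y \<in> zero_mean" "tv_norm E y \<le> 1" for y
    using that w1 by (metis dual_tv_norm_attained[OF assms] order_trans)
  show "\<forall>x. w \<bullet> x \<le> tv_norm E x"
  proof
    fix x :: "real ^ 'v"
    \<comment> \<open>Minus the mean of \<open>x\<close>. The shift brings \<open>x\<close> into
      \<open>zero_mean\<close> and changes neither its total variation nor its pairing with
      \<open>w\<close>.\<close>
    define a where "a = - (x \<bullet> 1) / (1 \<bullet> (1 :: real ^ 'v))"
    define y where "y = x + a *\<^sub>R 1"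
    have "1 \<bullet> (1 :: real ^ 'v) \<noteq> 0" by (simp add: inner_one_vec)
    then have y0: "y \<bullet> 1 = 0"
      by (simp add: y_def a_def inner_diff_left)
    have tvy: "tv_norm E y = tv_norm E x"
      unfolding y_def by (rule tv_norm_add_const[OF E])
    have wy: "w \<bullet> y = w \<bullet> x" by (simp add: y_def inner_add_right w0)
    show "w \<bullet> x \<le> tv_norm E x"
    proof (rule field_le_epsilon)
      fix e :: real assume "e > 0"
      \<comment> \<open>The slack \<open>e\<close> keeps the normalising factor positive even when
        the total variation of \<open>x\<close> is 0.\<close>
      define s where "s = tv_norm E x + e"
      have s: "s > 0" using tv_norm_nonneg[OF E, of x] \<open>e > 0\<close> by (simp add: s_def)
      have "(1 / s) *\<^sub>R y \<in> zero_mean" by (simp add: zero_mean_def y0)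
      moreover have "tv_norm E ((1 / s) *\<^sub>R y) \<le> 1"
        using s \<open>e > 0\<close> unfolding tv_norm_scale[OF E] tvy by (simp add: s_def)
      ultimately have "((1 / s) *\<^sub>R y) \<bullet> w \<le> 1" by (rule bound)
      then show "w \<bullet> x \<le> tv_norm E x + e"
        using s by (simp add: field_simps inner_commute wy) (simp add: s_def)
    qed
  qed
next
  have E: "undirected_edges E" using assms by (simp add: connected_graph_def)
  assume *: "\<forall>x. w \<bullet> x \<le> tv_norm E x"
  \<comment> \<open>The dual norm is a maximum, so the bound need only be evaluated at a
    maximizer.\<close>
  obtain x where x: "tv_norm E x \<le> 1" "x \<bullet> w = dual_tv_norm E w"
    using dual_tv_norm_attained[OF assms] by blast
  have "dual_tv_norm E w \<le> 1"
    using x *[rule_format, of x] by (simp add: inner_commute)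
  moreover have "w \<in> zero_mean"
    using zero_sum_if_inner_le_tv_norm[OF E, of w 1] * by (simp add: zero_mean_def inner_one_vec)
  ultimately show "w \<in> dual_tv_ball E" by (simp add: dual_tv_ball_def)
qed

lemma scaled_dual_tv_ball_iff:
  fixes E :: "'v::finite set set"
  assumes "connected_graph E" "lam > 0"
  shows "u \<in> (\<lambda>u. lam *\<^sub>R u) ` dual_tv_ball E \<longleftrightarrow> (\<forall>x. u \<bullet> x \<le> lam * tv_norm E x)"
proof -
  have "u \<in> (\<lambda>u. lam *\<^sub>R u) ` dual_tv_ball E \<longleftrightarrow> (1 / lam) *\<^sub>R u \<in> dual_tv_ball E"
  proof
    assume "(1 / lam) *\<^sub>R u \<in> dual_tv_ball E"
    then show "u \<in> (\<lambda>u. lam *\<^sub>R u) ` dual_tv_ball E"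
      by (rule rev_image_eqI) (use assms(2) in simp)
  qed (use assms(2) in auto)
  then show ?thesis
    using assms(2) by (simp add: dual_tv_ball_iff[OF assms(1)] field_simps)
qed

section \<open>Convexity, separation and the optimality condition\<close>

lemma convex_on_separable_sum:
  assumes "\<And>v. convex_on UNIV (f v)"
  shows "convex_on UNIV (separable_sum f)"
proof (rule convex_onI)
  fix t :: real and x y :: "real ^ 'a" assume "0 < t" "t < 1"
  then have "f v ((1 - t) * x $ v + t * y $ v) \<le> (1 - t) * f v (x $ v) + t * f v (y $ v)" for v
    using convex_onD[OF assms, of t "x $ v" "y $ v"] by simp
  then have "separable_sum f ((1 - t) *\<^sub>R x + t *\<^sub>R y)
      \<le> (\<Sum>v\<in>UNIV. (1 - t) * f v (x $ v) + t * f v (y $ v))"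
    unfolding separable_sum_def by (intro sum_mono) simp
  then show "separable_sum f ((1 - t) *\<^sub>R x + t *\<^sub>R y)
      \<le> (1 - t) * separable_sum f x + t * separable_sum f y"
    by (simp add: separable_sum_def sum.distrib sum_distrib_left)
qed simp

lemma convex_on_tv_norm:
  fixes E :: "'v::finite set set"
  assumes "undirected_edges E"
  shows "convex_on UNIV (tv_norm E)"
proof (rule convex_onI)
  fix t :: real and x y :: "real ^ 'v" assume "0 < t" "t < 1"
  then show "tv_norm E ((1 - t) *\<^sub>R x + t *\<^sub>R y) \<le> (1 - t) * tv_norm E x + t * tv_norm E y"
    using tv_norm_triangle[OF assms, of "(1 - t) *\<^sub>R x" "t *\<^sub>R y"]
    by (simp add: tv_norm_scale[OF assms])
qed simp

text \<open>Minimality says that the concave function \<open>- N\<close> lies below the increment of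
  \<open>F\<close> at \<open>a\<close>, and both vanish at 0. Separating them yields a linear
  functional between the two, and \<open>u\<close> is its slope.\<close>

lemma convex_sandwich_subgradient:
  fixes F N :: "'a::euclidean_space \<Rightarrow> real"
  assumes F: "convex_on UNIV F" and N: "convex_on UNIV N" and N0: "N 0 = 0"
    and min: "\<And>y. F a \<le> F (a + y) + N y"
  obtains u where "u \<in> subdifferential F a" "\<And>y. - (u \<bullet> y) \<le> N y"
proof -
  \<comment> \<open>\<open>S\<close> is the hypograph of \<open>- N\<close> and \<open>T\<close> the
    strict epigraph of the increment. Strictness makes them disjoint, although the two graphs meet
    at the origin.\<close>
  define S where "S = {(y, t). N y + t \<le> 0}"
  define T where "T = {(y, t). F (a + y) - F a < t}"
  have "convex S"
    unfolding convex_def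
  proof (clarsimp simp: S_def)
    fix x s y t and p q :: real
    assume h: "N x + s \<le> 0" "N y + t \<le> 0" "0 \<le> p" "0 \<le> q" "p + q = 1"
    have "N (p *\<^sub>R x + q *\<^sub>R y) \<le> p * N x + q * N y"
      using N h by (simp add: convex_on_def)
    also have "\<dots> \<le> p * (- s) + q * (- t)"
      using h by (intro add_mono mult_left_mono) auto
    finally show "N (p *\<^sub>R x + q *\<^sub>R y) + (p * s + q * t) \<le> 0" by simp
  qed
  moreover have "convex T"
    unfolding convex_def
  proof (clarsimp simp: T_def)
    fix x s y t and p q :: real
    assume h: "F (a + x) - F a < s" "F (a + y) - F a < t" "0 \<le> p" "0 \<le> q" "p + q = 1"
    have *: "a + (p *\<^sub>R x + q *\<^sub>R y) = p *\<^sub>R (a + x) + q *\<^sub>R (a + y)"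
      using h(5) by (simp add: algebra_simps flip: scaleR_add_left)
    have "F (a + (p *\<^sub>R x + q *\<^sub>R y)) - F a \<le> p * F (a + x) + q * F (a + y) - (p + q) * F a"
      unfolding * using F h by (simp add: convex_on_def)
    also have "\<dots> = p * (F (a + x) - F a) + q * (F (a + y) - F a)"
      by (simp add: algebra_simps)
    also have "\<dots> < p * s + q * t"
    \<comment> \<open>The first term gives a strict inequality only for \<open>p > 0\<close>; if
      \<open>p = 0\<close>, then \<open>q = 1\<close> and the second term is strict.\<close>
    proof (cases "p = 0")
      case False
      then show ?thesis using h by (intro add_less_le_mono mult_strict_left_mono mult_left_mono) auto
    qed (use h in simp)
    finally show "F (a + (p *\<^sub>R x + q *\<^sub>R y)) - F a < p * s + q * t" .
  qed
  moreover have S0: "(0, 0) \<in> S" and "(0, 1) \<in> T" by (auto simp: S_def T_def N0)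
  moreover have "S \<inter> T = {}"
  proof -
    have "\<not> (N y + t \<le> 0 \<and> F (a + y) - F a < t)" for y t
      using min[of y] by linarith
    then show ?thesis unfolding S_def T_def by blast
  qed
  ultimately obtain c \<beta> where "c \<noteq> 0"
    and S: "\<And>z. z \<in> S \<Longrightarrow> c \<bullet> z \<le> \<beta>" and T: "\<And>z. z \<in> T \<Longrightarrow> c \<bullet> z \<ge> \<beta>"
    using separating_hyperplane_sets[of S T] by blast
  obtain d b where c: "c = (d, b)" by (cases c)
  have S': "d \<bullet> y - b * N y \<le> \<beta>" for y using S[of "(y, - N y)"] by (simp add: S_def c)
  have T': "d \<bullet> y + b * t \<ge> \<beta>" if "F (a + y) - F a < t" for y t
    using T[of "(y, t)"] that by (simp add: T_def c)
  have \<beta>0: "\<beta> \<ge> 0" using S'[of 0] by (simp add: N0)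
  have "b \<ge> 0" using T'[of 0 1] \<beta>0 by simp
  \<comment> \<open>A vertical hyperplane is impossible: \<open>S\<close> and \<open>T\<close> both
    project onto the whole space, so \<open>d\<close> would pair with every vector to the same
    value, forcing \<open>d = 0\<close> and hence \<open>c = 0\<close>.\<close>
  moreover have "b \<noteq> 0"
  proof
    assume "b = 0"
    then have "d \<bullet> y \<le> \<beta>" "\<beta> \<le> d \<bullet> y" for y
      using S'[of y] T'[of y "F (a + y) - F a + 1"] by auto
    then have "d \<bullet> y = \<beta>" for y by (simp add: order_antisym)
    from this[of 0] this[of d] have "d = 0" by simp
    with \<open>b = 0\<close> \<open>c \<noteq> 0\<close> c show False by (simp add: zero_prod_def)
  qed
  ultimately have b: "b > 0" by simp
  \<comment> \<open>The points \<open>(0, e)\<close> of \<open>T\<close> approach the origin. Taking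
    \<open>e\<close> to be half of \<open>\<beta> / b\<close> excludes \<open>\<beta> > 0\<close>,
    so the hyperplane passes through the origin.\<close>
  have "\<beta> \<le> b * e" if "e > 0" for e using T'[of 0 e] that by simp
  from this[of "\<beta> / (2 * b)"] b \<beta>0 have \<beta>: "\<beta> = 0" by (cases "\<beta> = 0") auto
  \<comment> \<open>Solving \<open>d \<bullet> y + b * t = 0\<close> for \<open>t\<close> presents
    the hyperplane as the graph of the functional with slope \<open>u\<close>.\<close>
  define u where "u = (- 1 / b) *\<^sub>R d"
  have d: "d = (- b) *\<^sub>R u" using b by (simp add: u_def)
  have "u \<bullet> y \<le> F (a + y) - F a" for y
  proof (rule dense_ge)
    fix t assume "F (a + y) - F a < t"
    from T'[OF this] show "u \<bullet> y \<le> t" using b by (simp add: \<beta> d)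
  qed
  from this[of "_ - a"] have "u \<in> subdifferential F a"
    by (simp add: subdifferential_def algebra_simps)
  moreover have "- (u \<bullet> y) \<le> N y" for y
  proof -
    have "b * (- (u \<bullet> y)) \<le> b * N y" using S'[of y] by (simp add: \<beta> d)
    then show ?thesis using b by (simp only: mult_le_cancel_left_pos)
  qed
  ultimately show thesis by (rule that)
qed

text \<open>Forwards, the sandwich is applied to displacements from the constant, which have the
  same total variation as the displaced point. Backwards, \<open>u\<close> is orthogonal to
  \<open>1\<close>, so the subgradient inequality bounds the loss in \<open>F\<close> by
  \<open>- (u \<bullet> x)\<close>, which the total variation term compensates.\<close>

lemma const_minimizer_iff_subgradient:
  fixes E :: "'v::finite set set" and F :: "real ^ 'v \<Rightarrow> real"
  assumes E: "undirected_edges E" and "lam \<ge> 0" and F: "convex_on UNIV F"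
  shows "(\<forall>x. F (c *\<^sub>R 1) + lam * tv_norm E (c *\<^sub>R 1) \<le> F x + lam * tv_norm E x)
    \<longleftrightarrow> (\<exists>u \<in> subdifferential F (c *\<^sub>R 1). \<forall>x. u \<bullet> x \<le> lam * tv_norm E x)"
proof
  assume min: "\<forall>x. F (c *\<^sub>R 1) + lam * tv_norm E (c *\<^sub>R 1) \<le> F x + lam * tv_norm E x"
  have "convex_on UNIV (\<lambda>y. lam * tv_norm E y)"
    by (rule convex_on_cmul[OF \<open>lam \<ge> 0\<close> convex_on_tv_norm[OF E]])
  moreover have "lam * tv_norm E 0 = 0" using tv_norm_const[OF E, of 0] by simp
  moreover have "F (c *\<^sub>R 1) \<le> F (c *\<^sub>R 1 + y) + lam * tv_norm E y" for y
    using min[rule_format, of "y + c *\<^sub>R 1"]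
    unfolding tv_norm_add_const[OF E] tv_norm_const[OF E] by (simp add: add.commute)
  ultimately obtain u where u: "u \<in> subdifferential F (c *\<^sub>R 1)"
    and le: "\<And>y. - (u \<bullet> y) \<le> lam * tv_norm E y"
    by (rule convex_sandwich_subgradient[OF F]) blast
  \<comment> \<open>The total variation is even, so the sign in \<open>le\<close> can be
    flipped.\<close>
  have "u \<bullet> x \<le> lam * tv_norm E x" for x
    using le[of "(-1) *\<^sub>R x"] unfolding tv_norm_scale[OF E] by simp
  with u show "\<exists>u \<in> subdifferential F (c *\<^sub>R 1). \<forall>x. u \<bullet> x \<le> lam * tv_norm E x" by blast
next
  assume "\<exists>u \<in> subdifferential F (c *\<^sub>R 1). \<forall>x. u \<bullet> x \<le> lam * tv_norm E x"
  then obtain u where u: "\<And>x. F (c *\<^sub>R 1) + u \<bullet> (x - c *\<^sub>R 1) \<le> F x"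
    and le: "\<And>x. u \<bullet> x \<le> lam * tv_norm E x"
    by (auto simp: subdifferential_def)
  have u1: "u \<bullet> 1 = 0"
    using zero_sum_if_inner_le_tv_norm[OF E le] by (simp add: inner_one_vec)
  show "\<forall>x. F (c *\<^sub>R 1) + lam * tv_norm E (c *\<^sub>R 1) \<le> F x + lam * tv_norm E x"
  proof
    fix x
    have "- (u \<bullet> x) \<le> lam * tv_norm E x"
      using le[of "(-1) *\<^sub>R x"] unfolding tv_norm_scale[OF E] by simp
    then show "F (c *\<^sub>R 1) + lam * tv_norm E (c *\<^sub>R 1) \<le> F x + lam * tv_norm E x"
      using u[of x] unfolding tv_norm_const[OF E] by (simp add: inner_diff_right u1)
  qed
qed

section \<open>Passage through the common subgradient condition \<open>Q\<close>\<close>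

theorem theorem1:
  fixes E :: "'v::finite set set"
    and lam :: real
    and f :: "'v \<Rightarrow> real \<Rightarrow> real"
    and xstar :: real
  assumes "connected_graph E"
    and "lam > 0"
    and "\<And>v. convex_on UNIV (f v)"
    and "\<exists>z. is_arg_min (\<lambda>x. \<Sum>v\<in>UNIV. f v x) (\<lambda>_. True) z"
  shows
    "let S1 = is_arg_min (\<lambda>x. (\<Sum>v\<in>UNIV. f v (x $ v)) + lam * tv_norm E x) (\<lambda>_. True)
                (xstar *\<^sub>R (1 :: real ^ 'v));
         S2 = subdifferential (separable_sum f) (xstar *\<^sub>R 1)
                \<inter> (\<lambda>u. lam *\<^sub>R u) ` dual_tv_ball E \<noteq> {};
         S3 = (\<exists>u\<in>subdifferential (separable_sum f) (xstar *\<^sub>R 1).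
                (\<Sum>v\<in>UNIV. u $ v) = 0 \<and>
                (\<forall>A. (\<Sum>v\<in>A. u $ v) \<le> lam * perimeter E A));
         S4 = is_arg_min (\<lambda>x. \<Sum>v\<in>UNIV. f v x) (\<lambda>_. True) xstar
     in (S1 \<longleftrightarrow> S2) \<and> (S2 \<longleftrightarrow> S3) \<and>
        (S1 \<longrightarrow> S4) \<and> (S2 \<longrightarrow> S4) \<and> (S3 \<longrightarrow> S4)"
proof -
  have E: "undirected_edges E" using assms(1) by (simp add: connected_graph_def)
  define F where "F = separable_sum f"
  define Q where "Q \<longleftrightarrow>
    (\<exists>u\<in>subdifferential F (xstar *\<^sub>R 1). \<forall>x. u \<bullet> x \<le> lam * tv_norm E x)"
  have 1: "is_arg_min (\<lambda>x. (\<Sum>v\<in>UNIV. f v (x $ v)) + lam * tv_norm E x) (\<lambda>_. True)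
      (xstar *\<^sub>R (1 :: real ^ 'v)) \<longleftrightarrow> Q"
    using const_minimizer_iff_subgradient[OF E less_imp_le[OF assms(2)]
        convex_on_separable_sum[OF assms(3)], where c = xstar]
    unfolding is_arg_min_def Q_def F_def separable_sum_def by (simp add: not_less)
  have 2: "subdifferential F (xstar *\<^sub>R 1) \<inter> (\<lambda>u. lam *\<^sub>R u) ` dual_tv_ball E \<noteq> {}
      \<longleftrightarrow> Q"
    unfolding Q_def scaled_dual_tv_ball_iff[OF assms(1,2), symmetric] by blast
  have 3: "(\<exists>u\<in>subdifferential F (xstar *\<^sub>R 1). (\<Sum>v\<in>UNIV. u $ v) = 0 \<and>
      (\<forall>A. (\<Sum>v\<in>A. u $ v) \<le> lam * perimeter E A)) \<longleftrightarrow> Q"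
    unfolding Q_def inner_le_tv_norm_iff_perimeter[OF E] ..
  have 4: "is_arg_min (\<lambda>x. \<Sum>v\<in>UNIV. f v x) (\<lambda>_. True) xstar" if Q
  proof -
    have "(\<Sum>v\<in>UNIV. f v xstar) \<le> (\<Sum>v\<in>UNIV. f v x)" for x
    proof -
      \<comment> \<open>Comparing only with constant functions makes both total variation terms
        vanish and leaves the scalar problem.\<close>
      have "(\<Sum>v\<in>UNIV. f v ((xstar *\<^sub>R (1 :: real ^ 'v)) $ v)) + lam * tv_norm E (xstar *\<^sub>R 1)
          \<le> (\<Sum>v\<in>UNIV. f v ((x *\<^sub>R (1 :: real ^ 'v)) $ v)) + lam * tv_norm E (x *\<^sub>R 1)"
        using that unfolding 1[symmetric] is_arg_min_def not_ex by (metis not_less)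
      then show ?thesis unfolding tv_norm_const[OF E] by simp
    qed
    then show ?thesis by (simp add: is_arg_min_def not_less)
  qed
  show ?thesis
    unfolding Let_def 1 2[unfolded F_def] 3[unfolded F_def] using 4 by blast
qed

end
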